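(* If $G$ is a connected graph of order $n \geq 2$, then $\mathrm{Det}(G \circ K_1) = \mathrm{Det}(G)$.
   Context: Graphs are finite and simple; the order of a graph is its number of vertices, and $K_1$ is the graph with a single vertex. The corona product $G \circ H$ of two graphs $G$ and $H$ is the graph obtained by taking one copy of $G$ and $|V(G)|$ copies of $H$ and joining the $i$-th vertex of $G$ to every vertex in the $i$-th copy of $H$. For a graph $G$ with vertex set $V(G)$, a subset $S \subseteq V(G)$ is a determining set for $G$ if whenever $g,h \in \mathrm{Aut}(G)$ satisfy $g(s) = h(s)$ for all $s \in S$, then $g = h$. The determining number $\mathrm{Det}(G)$ is the minimum cardinality of a determining set of $G$. *)

theory Defs
  imports "Graph_Theory.Graph_Theory" "HOL-Combinatorics.Permutations"
begin

(* Finite simple graphs are the pair_graph's of Graph_Theory: finite, symmetric, loop-free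
   digraphs whose arcs are pairs of vertices; the undirected edge uv is the two arcs
   (u, v) and (v, u). *)

(* Inl v is the vertex v of the copy of G; Inr (v, x) is the vertex x in the copy of H
   belonging to v. The last two sets of arcs are the two directions of the joining edges. *)
definition corona ::
  "'a pair_pre_digraph \<Rightarrow> 'b pair_pre_digraph \<Rightarrow> ('a + 'a \<times> 'b) pair_pre_digraph" where
  "corona G H =
    \<lparr> pverts = Inl ` pverts G \<union> Inr ` (pverts G \<times> pverts H),
      parcs = {(Inl u, Inl v) | u v. (u, v) \<in> parcs G}
        \<union> {(Inr (v, x), Inr (v, y)) | v x y. v \<in> pverts G \<and> (x, y) \<in> parcs H}
        \<union> {(Inl v, Inr (v, x)) | v x. v \<in> pverts G \<and> x \<in> pverts H}
        \<union> {(Inr (v, x), Inl v) | v x. v \<in> pverts G \<and> x \<in> pverts H} \<rparr>"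

(* "permutes" makes f the identity outside the vertex set, so that equality of
   automorphisms is equality of functions. *)
definition Aut :: "'a pair_pre_digraph \<Rightarrow> ('a \<Rightarrow> 'a) set" where
  "Aut G = {f. f permutes pverts G \<and>
    (\<forall>u \<in> pverts G. \<forall>v \<in> pverts G. (u, v) \<in> parcs G \<longleftrightarrow> (f u, f v) \<in> parcs G)}"

definition determining_set :: "'a pair_pre_digraph \<Rightarrow> 'a set \<Rightarrow> bool" where
  "determining_set G S \<longleftrightarrow> S \<subseteq> pverts G \<and>
    (\<forall>g \<in> Aut G. \<forall>h \<in> Aut G. (\<forall>s \<in> S. g s = h s) \<longrightarrow> g = h)"

definition Det :: "'a pair_pre_digraph \<Rightarrow> nat" where
  "Det G = (LEAST n. \<exists>S. determining_set G S \<and> card S = n)"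

lemma pair_graph_corona:
  assumes "pair_graph G" "pair_graph H"
  shows "pair_graph (corona G H)"
proof -
  interpret G: pair_graph G by fact
  interpret H: pair_graph H by fact
  have sG: "(v, u) \<in> parcs G" if "(u, v) \<in> parcs G" for u v
    using G.pair_sym_arcs that by (auto simp: symmetric_def sym_def)
  have sH: "(v, u) \<in> parcs H" if "(u, v) \<in> parcs H" for u v
    using H.pair_sym_arcs that by (auto simp: symmetric_def sym_def)
  have wf: "parcs (corona G H) \<subseteq> pverts (corona G H) \<times> pverts (corona G H)"
    by (auto simp: corona_def dest: G.in_arcsD1 G.in_arcsD2 H.in_arcsD1 H.in_arcsD2)
  have fin: "finite (pverts (corona G H))"
    by (simp add: corona_def G.pair_finite_verts H.pair_finite_verts)
  show ?thesis
  proof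
    fix e assume e: "e \<in> parcs (corona G H)"
    show "fst e \<in> pverts (corona G H)" "snd e \<in> pverts (corona G H)"
      using wf e by auto
    show "fst e \<noteq> snd e"
      using e G.pair_no_loops H.pair_no_loops by (fastforce simp: corona_def)
  next
    show "finite (pverts (corona G H))" by (fact fin)
    show "finite (parcs (corona G H))"
      using finite_subset[OF wf] fin by blast
    show "symmetric (with_proj (corona G H))"
      unfolding symmetric_def sym_def by (auto simp: corona_def dest: sG sH)
  qed
qed

(* Agreement with the isomorphisms of Graph_Theory. *)
lemma Aut_iff_digraph_isomorphism:
  assumes "pair_wf_digraph G"
  shows "f \<in> Aut G \<longleftrightarrow> f permutes pverts G \<and>
    (\<exists>hom. iso_verts hom = f \<and> pre_digraph.digraph_isomorphism (with_proj G) hom \<and>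
      app_iso hom (with_proj G) = with_proj G)"
proof -
  interpret pair_wf_digraph G by fact
  have wf: "wf_digraph (with_proj G)" by (fact wf_digraph)
  have wfa: "u \<in> pverts G" "v \<in> pverts G" if "(u, v) \<in> parcs G" for u v
    using that by (auto dest: in_arcsD1 in_arcsD2)
  show ?thesis
  proof (intro iffI conjI)
    assume f: "f \<in> Aut G"
    then show perm: "f permutes pverts G" by (simp add: Aut_def)
    have inj: "inj f" using perm by (rule permutes_inj)
    have pres: "(f u, f v) \<in> parcs G \<longleftrightarrow> (u, v) \<in> parcs G"
      if "u \<in> pverts G" "v \<in> pverts G" for u v
      using f that by (auto simp: Aut_def)
    have img: "map_prod f f ` parcs G = parcs G"
    proof (intro equalityI subsetI)
      fix e assume "e \<in> map_prod f f ` parcs G"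
      then show "e \<in> parcs G" using pres wfa by auto
    next
      fix e assume e: "e \<in> parcs G"
      obtain a b where ab: "e = (a, b)" by (cases e)
      then have "a \<in> f ` pverts G" "b \<in> f ` pverts G"
        using e wfa permutes_image[OF perm] by auto
      then obtain u v where uv: "u \<in> pverts G" "v \<in> pverts G" "a = f u" "b = f v" by blast
      then have "(u, v) \<in> parcs G" using pres e ab by auto
      then show "e \<in> map_prod f f ` parcs G" using uv ab by force
    qed
    let ?h = "\<lparr>iso_verts = f, iso_arcs = map_prod f f, iso_head = snd, iso_tail = fst\<rparr>"
    have "pre_digraph.digraph_isomorphism (with_proj G) ?h"
      unfolding pre_digraph.digraph_isomorphism_def
      using wf inj by (auto intro: inj_on_subset simp: inj_on_def)
    moreover have "app_iso ?h (with_proj G) = with_proj G"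
      using permutes_image[OF perm] img by (simp add: app_iso_def with_proj_def)
    ultimately show "\<exists>hom. iso_verts hom = f \<and>
      pre_digraph.digraph_isomorphism (with_proj G) hom \<and>
      app_iso hom (with_proj G) = with_proj G"
      by (intro exI[of _ ?h]) simp
  next
    assume R: "f permutes pverts G \<and> (\<exists>hom. iso_verts hom = f \<and>
      pre_digraph.digraph_isomorphism (with_proj G) hom \<and>
      app_iso hom (with_proj G) = with_proj G)"
    then obtain h where perm: "f permutes pverts G" and h: "iso_verts h = f"
      "pre_digraph.digraph_isomorphism (with_proj G) h"
      "app_iso h (with_proj G) = with_proj G" by blast
    have ht: "iso_head h = snd" "iso_tail h = fst" "iso_arcs h ` parcs G = parcs G"
      using h(3) by (auto simp: app_iso_def with_proj_def)
    have arc: "iso_arcs h (u, v) = (f u, f v)" if "(u, v) \<in> parcs G" for u v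
      using h(1,2) ht that unfolding pre_digraph.digraph_isomorphism_def
      by (fastforce simp: prod_eq_iff)
    have inj: "inj f" using perm by (rule permutes_inj)
    have "(u, v) \<in> parcs G \<longleftrightarrow> (f u, f v) \<in> parcs G" for u v
    proof
      assume "(u, v) \<in> parcs G" then show "(f u, f v) \<in> parcs G"
        using arc ht(3) by force
    next
      assume "(f u, f v) \<in> parcs G"
      then obtain x y where xy: "(x, y) \<in> parcs G" "iso_arcs h (x, y) = (f u, f v)"
        using ht(3) by (metis imageE surj_pair)
      then have "x = u" "y = v" using arc inj by (auto dest: injD)
      with xy show "(u, v) \<in> parcs G" by simp
    qed
    then show "f \<in> Aut G" using perm by (simp add: Aut_def)
  qed
qed

(* The LEAST in Det is attained, the whole vertex set being determining. *)
lemma determining_set_pverts: "determining_set G (pverts G)"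
  unfolding determining_set_def Aut_def by (auto simp: fun_eq_iff permutes_def)

end

theory Submission
  imports Defs
begin

text \<open>
  The corona of \<open>G\<close> with a single vertex hangs one pendant vertex on every vertex of \<open>G\<close>, and the
  theorem holds because this changes nothing about the automorphism group or about how it is
  detected by fixed vertices.

  Every automorphism \<open>f\<close> of \<open>G\<close> lifts to the corona by moving each pendant vertex along with the
  vertex carrying it. Conversely, every automorphism of the corona is such a lift
  (\<open>Aut_corona_eq\<close>). Here connectedness enters: a connected graph on at least two vertices has no
  isolated vertex, so in the corona each vertex of \<open>G\<close> has at least two neighbours, while each
  pendant vertex has only one. Automorphisms therefore map pendant vertices to pendant
  vertices and \<open>G\<close> to \<open>G\<close>, and a pendant vertex has to follow its only neighbour.

  Two lifts agree on the pendant vertex at \<open>v\<close> exactly if they agree on \<open>v\<close>. Hence a set of vertices of the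
  corona determines the automorphisms of the corona if and only if its projection to \<open>G\<close>
  determines those of \<open>G\<close> (\<open>determining_set_corona_iff\<close>). Projecting does not increase
  cardinality, and every subset of \<open>G\<close> is its own projection, so the two minimum cardinalities agree.
\<close>

text \<open>
  The absence of isolated vertices is what tells \<open>G\<close> and the pendant vertices apart: over an isolated
  vertex the corona has a separate edge, whose two ends can be swapped without moving anything in \<open>G\<close>.
\<close>

locale pendant_corona = pair_graph G for G :: "'a pair_pre_digraph" +
  fixes K :: "'b pair_pre_digraph" and x :: 'b
  assumes pverts_K: "pverts K = {x}" and parcs_K: "parcs K = {}"
    and no_isolated: "v \<in> pverts G \<Longrightarrow> \<exists>u. (v, u) \<in> parcs G"
begin

lemma pverts_corona: "pverts (corona G K) = Inl ` pverts G \<union> (\<lambda>v. Inr (v, x)) ` pverts G"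
  by (auto simp: corona_def pverts_K)

lemma parcs_corona:
  "(Inl u, Inl v) \<in> parcs (corona G K) \<longleftrightarrow> (u, v) \<in> parcs G"
  "(Inl u, Inr (v, y)) \<in> parcs (corona G K) \<longleftrightarrow> u = v \<and> v \<in> pverts G \<and> y = x"
  "(Inr (v, y), Inl u) \<in> parcs (corona G K) \<longleftrightarrow> u = v \<and> v \<in> pverts G \<and> y = x"
  "(Inr (u, y), Inr (v, z)) \<notin> parcs (corona G K)"
  by (auto simp: corona_def pverts_K parcs_K)

text \<open>
  The elements \<open>Inr (v, y)\<close> with \<open>y \<noteq> x\<close> are not vertices of the corona. The lift leaves them in
  place, because an automorphism has to be the identity outside the vertex set.
\<close>

definition lift :: "('a \<Rightarrow> 'a) \<Rightarrow> 'a + 'a \<times> 'b \<Rightarrow> 'a + 'a \<times> 'b" where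
  "lift f p = (case p of Inl v \<Rightarrow> Inl (f v)
    | Inr (v, y) \<Rightarrow> if y = x then Inr (f v, x) else Inr (v, y))"

lemma lift_simps [simp]:
  "lift f (Inl v) = Inl (f v)"
  "lift f (Inr (v, x)) = Inr (f v, x)"
  "y \<noteq> x \<Longrightarrow> lift f (Inr (v, y)) = Inr (v, y)"
  by (auto simp: lift_def)

lemma lift_inject [simp]: "lift f = lift g \<longleftrightarrow> f = g"
proof
  assume "lift f = lift g"
  then have "lift f (Inl v) = lift g (Inl v)" for v by simp
  then show "f = g" by (simp add: fun_eq_iff)
qed simp

lemma lift_comp: "lift f \<circ> lift g = lift (f \<circ> g)"
  by (auto simp: fun_eq_iff lift_def split: sum.splits)

lemma lift_id: "lift id = id"
  by (auto simp: fun_eq_iff lift_def split: sum.splits)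

lemma lift_permutes:
  assumes f: "f permutes pverts G"
  shows "lift f permutes pverts (corona G K)"
proof -
  have "bij (lift f)"
    by (rule o_bij[of "lift (inv f)"]) (simp_all add: lift_comp permutes_inv_o[OF f] lift_id)
  moreover have "lift f p = p" if "p \<notin> pverts (corona G K)" for p
    using that permutes_not_in[OF f]
    by (auto simp: lift_def pverts_corona split: sum.splits)
  ultimately show ?thesis by (auto simp: permutes_def bij_iff)
qed

lemma lift_Aut:
  assumes "f \<in> Aut G"
  shows "lift f \<in> Aut (corona G K)"
proof -
  have perm: "f permutes pverts G"
    and arcs: "\<And>u v. u \<in> pverts G \<Longrightarrow> v \<in> pverts G \<Longrightarrow> (u, v) \<in> parcs G \<longleftrightarrow> (f u, f v) \<in> parcs G"
    using assms by (auto simp: Aut_def)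
  have inj: "f u = f v \<longleftrightarrow> u = v" for u v using permutes_inj[OF perm] by (auto dest: injD)
  show ?thesis
    using lift_permutes[OF perm]
    by (auto simp: Aut_def pverts_corona parcs_corona inj permutes_in_image[OF perm] arcs[symmetric])
qed

text \<open>
  The graph-theoretic characterisation of the pendant vertices, and so the reason why
  automorphisms preserve them: a vertex \<open>v\<close> of \<open>G\<close> is joined both to its own pendant vertex and
  to some neighbour in \<open>G\<close>.
\<close>

lemma pendant_iff_unique_neighbour:
  assumes "p \<in> pverts (corona G K)"
  shows "(\<exists>v. p = Inr (v, x)) \<longleftrightarrow>
    (\<forall>q r. (p, q) \<in> parcs (corona G K) \<longrightarrow> (p, r) \<in> parcs (corona G K) \<longrightarrow> q = r)"
    (is "_ \<longleftrightarrow> ?unique")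
proof (cases p)
  case (Inl v)
  then have v: "v \<in> pverts G" using assms by (auto simp: pverts_corona)
  then obtain u where "(v, u) \<in> parcs G" using no_isolated by blast
  then have "(p, Inl u) \<in> parcs (corona G K)" "(p, Inr (v, x)) \<in> parcs (corona G K)"
    using v by (simp_all add: Inl parcs_corona)
  then have "\<not> ?unique" by blast
  then show ?thesis by (simp add: Inl)
next
  case (Inr w)
  then obtain v where p: "p = Inr (v, x)" using assms by (auto simp: pverts_corona)
  have "q = Inl v" if "(p, q) \<in> parcs (corona G K)" for q
    using that by (cases q) (auto simp: p parcs_corona)
  then show ?thesis using p by blast
qed

lemma Aut_corona_pendant_iff:
  assumes h: "h \<in> Aut (corona G K)" and p: "p \<in> pverts (corona G K)"
  shows "(\<exists>v. h p = Inr (v, x)) \<longleftrightarrow> (\<exists>v. p = Inr (v, x))"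
proof -
  let ?C = "corona G K"
  have perm: "h permutes pverts ?C" using h by (simp add: Aut_def)
  have hp: "h p \<in> pverts ?C" using p permutes_in_image[OF perm] by simp
  have arcs: "(p, q) \<in> parcs ?C \<longleftrightarrow> (h p, h q) \<in> parcs ?C" for q
  proof (cases "q \<in> pverts ?C")
    case True
    then show ?thesis using h p by (simp add: Aut_def)
  next
    case False
    \<comment> \<open>Both sides fail, since \<open>h\<close> fixes \<open>q\<close> and no arc ends outside the vertex set.\<close>
    have "(r, q) \<notin> parcs ?C" for r
      using False by (auto simp: corona_def pverts_K parcs_K dest: in_arcsD1 in_arcsD2)
    then show ?thesis using permutes_not_in[OF perm False] by simp
  qed
  have "(\<forall>q r. (p, q) \<in> parcs ?C \<longrightarrow> (p, r) \<in> parcs ?C \<longrightarrow> q = r) \<longleftrightarrow>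
    (\<forall>q r. (h p, q) \<in> parcs ?C \<longrightarrow> (h p, r) \<in> parcs ?C \<longrightarrow> q = r)"
    by (metis arcs permutes_inverses(1)[OF perm] permutes_inverses(2)[OF perm])
  then show ?thesis using pendant_iff_unique_neighbour[OF p] pendant_iff_unique_neighbour[OF hp]
    by simp
qed

lemma Aut_corona_is_lift:
  assumes h: "h \<in> Aut (corona G K)"
  obtains f where "f \<in> Aut G" "h = lift f"
proof -
  let ?C = "corona G K"
  have perm: "h permutes pverts ?C"
    and arcs: "\<And>p q. p \<in> pverts ?C \<Longrightarrow> q \<in> pverts ?C \<Longrightarrow> (p, q) \<in> parcs ?C \<longleftrightarrow> (h p, h q) \<in> parcs ?C"
    using h by (auto simp: Aut_def)
  note in_C = permutes_in_image[OF perm]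
  have Inl_C: "Inl v \<in> pverts ?C \<longleftrightarrow> v \<in> pverts G" for v by (auto simp: pverts_corona)
  have Inr_C: "Inr (v, y) \<in> pverts ?C \<longleftrightarrow> v \<in> pverts G \<and> y = x" for v y
    by (auto simp: pverts_corona)
  define f where "f v = projl (h (Inl v))" for v
  have base: "h (Inl v) = Inl (f v)" for v
  proof (cases "v \<in> pverts G")
    case True
    then have "h (Inl v) \<in> pverts ?C" "\<nexists>w. h (Inl v) = Inr (w, x)"
      using Aut_corona_pendant_iff[OF h, of "Inl v"] by (auto simp: in_C Inl_C)
    then show ?thesis by (auto simp: f_def pverts_corona)
  next
    case False
    then show ?thesis by (simp add: f_def permutes_not_in[OF perm] Inl_C)
  qed
  have f_out: "f v = v" if "v \<notin> pverts G" for v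
    using that by (simp add: f_def permutes_not_in[OF perm] Inl_C)
  have pendant: "h (Inr (v, x)) = Inr (f v, x)" for v
  proof (cases "v \<in> pverts G")
    case True
    obtain w where w: "h (Inr (v, x)) = Inr (w, x)"
      using Aut_corona_pendant_iff[OF h, of "Inr (v, x)"] True by (auto simp: Inr_C)
    have "(h (Inl v), h (Inr (v, x))) \<in> parcs ?C"
      using True by (subst arcs[symmetric]) (auto simp: Inl_C Inr_C parcs_corona)
    then show ?thesis by (simp add: w base parcs_corona)
  next
    case False
    then show ?thesis by (simp add: permutes_not_in[OF perm] Inr_C f_out)
  qed
  have "h p = lift f p" for p
  proof (cases p)
    case (Inr w)
    then show ?thesis
      by (cases w, cases "snd w = x") (auto simp: pendant permutes_not_in[OF perm] Inr_C)
  qed (simp add: base)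
  then have hf: "h = lift f" by blast
  have in_G: "f v \<in> pverts G \<longleftrightarrow> v \<in> pverts G" for v
    using in_C[of "Inl v"] by (simp add: base Inl_C)
  have "inj f"
    using permutes_inj[OF perm] by (metis base injD injI old.sum.inject(1))
  then have "inj_on f (pverts G)" by (rule inj_on_subset) simp
  moreover have "f ` pverts G \<subseteq> pverts G" using in_G by blast
  ultimately have "bij_betw f (pverts G) (pverts G)"
    using pair_finite_verts by (metis bij_betw_def endo_inj_surj)
  then have "f permutes pverts G" using f_out by (rule bij_imp_permutes)
  moreover have "(u, v) \<in> parcs G \<longleftrightarrow> (f u, f v) \<in> parcs G"
    if "u \<in> pverts G" "v \<in> pverts G" for u v
    using arcs[of "Inl u" "Inl v"] that by (simp add: Inl_C base parcs_corona)
  ultimately have "f \<in> Aut G" by (simp add: Aut_def)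
  then show thesis using hf by (rule that)
qed

lemma Aut_corona_eq: "Aut (corona G K) = lift ` Aut G"
  using lift_Aut Aut_corona_is_lift by blast

definition proj :: "'a + 'a \<times> 'b \<Rightarrow> 'a" where
  "proj p = (case p of Inl v \<Rightarrow> v | Inr (v, y) \<Rightarrow> v)"

lemma proj_Inl [simp]: "proj (Inl v) = v"
  by (simp add: proj_def)

lemma lift_agree_iff:
  assumes "p \<in> pverts (corona G K)"
  shows "lift f p = lift g p \<longleftrightarrow> f (proj p) = g (proj p)"
  using assms by (auto simp: pverts_corona proj_def)

lemma determining_set_corona_iff:
  assumes "T \<subseteq> pverts (corona G K)"
  shows "determining_set (corona G K) T \<longleftrightarrow> determining_set G (proj ` T)"
proof -
  have "proj ` T \<subseteq> pverts G" using assms by (auto simp: pverts_corona proj_def)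
  moreover have "(\<forall>p \<in> T. lift f p = lift g p) \<longleftrightarrow> (\<forall>s \<in> proj ` T. f s = g s)" for f g
    using assms lift_agree_iff by blast
  ultimately show ?thesis using assms by (simp add: determining_set_def Aut_corona_eq)
qed

lemma Det_le: "determining_set H S \<Longrightarrow> Det H \<le> card S"
  unfolding Det_def by (rule Least_le) blast

lemma Det_attained: obtains S where "determining_set H S" "card S = Det H"
  unfolding Det_def
  using LeastI_ex[of "\<lambda>n. \<exists>S. determining_set H S \<and> card S = n"] determining_set_pverts by blast

lemma Det_corona: "Det (corona G K) = Det G"
proof (rule antisym)
  obtain S where S: "determining_set G S" "card S = Det G" by (rule Det_attained)
  have "Inl ` S \<subseteq> pverts (corona G K)"
    using S(1) by (auto simp: determining_set_def pverts_corona)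
  moreover have "proj ` Inl ` S = S" by (simp add: image_image)
  ultimately have "determining_set (corona G K) (Inl ` S)"
    using S(1) by (simp add: determining_set_corona_iff)
  then show "Det (corona G K) \<le> Det G" using Det_le S(2) by (metis card_image inj_Inl)
next
  obtain T where T: "determining_set (corona G K) T" "card T = Det (corona G K)"
    by (rule Det_attained)
  then have sub: "T \<subseteq> pverts (corona G K)" by (simp add: determining_set_def)
  then have "finite T" by (rule finite_subset) (simp add: pverts_corona pair_finite_verts)
  have "Det G \<le> card (proj ` T)"
    using T(1) sub by (intro Det_le) (simp add: determining_set_corona_iff)
  also have "\<dots> \<le> card T" using \<open>finite T\<close> by (rule card_image_le)
  finally show "Det G \<le> Det (corona G K)" using T(2) by simp
qed

end

text \<open>
  A walk from \<open>v\<close> to any other vertex has to start with an arc leaving \<open>v\<close>.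
\<close>

lemma connected_imp_no_isolated:
  assumes "pair_graph G" "connected (with_proj G)" "card (pverts G) \<ge> 2" "v \<in> pverts G"
  shows "\<exists>u. (v, u) \<in> parcs G"
proof -
  interpret pair_graph G by fact
  have "\<not> pverts G \<subseteq> {v}" using assms(3) card_mono[of "{v}" "pverts G"] by auto
  then obtain w where w: "w \<in> pverts G" "w \<noteq> v" by blast
  then have "v \<rightarrow>\<^sup>*\<^bsub>mk_symmetric (with_proj G)\<^esub> w"
    using assms(2,4) by (simp add: connected_def strongly_connected_def)
  then have "v \<rightarrow>\<^sup>*\<^bsub>with_proj G\<^esub> w"
    using reachable_mk_symmetric_eq[OF pair_sym_arcs] by simp
  then show ?thesis using w(2) by (auto elim: converse_reachable_cases)
qed

lemma complete_digraph_1_pair: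
  assumes "complete_digraph 1 (with_proj K)"
  obtains x where "pverts K = {x}" "parcs K = {}"
proof -
  obtain x where x: "pverts K = {x}"
    using assms by (auto simp: complete_digraph_pair_def card_1_singleton_iff)
  then have "parcs K = {}" using assms by (auto simp: complete_digraph_pair_def)
  with x show thesis by (rule that)
qed

theorem theorem3p2:
  fixes G :: "'a pair_pre_digraph" and K :: "'b pair_pre_digraph"
  assumes "pair_graph G"
    and "connected (with_proj G)"
    and "card (pverts G) \<ge> 2"
    and "complete_digraph 1 (with_proj K)"
  shows "Det (corona G K) = Det G"
proof -
  obtain x where "pverts K = {x}" "parcs K = {}"
    using assms(4) by (rule complete_digraph_1_pair)
  then interpret pendant_corona G K x
    using assms(1) connected_imp_no_isolated[OF assms(1-3)]
    by (intro pendant_corona.intro pendant_corona_axioms.intro)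
  show ?thesis by (rule Det_corona)
qed

end
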